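(* For every $d$, $D$, and $k$ there exists $N=N(d,D,k)$, for which an explicit bound can be given, such that for every $d$-dimensional $k$-ary algebraic predicate $\Phi$ in which all the polynomials have degree at most $D$, the following two conditions are equivalent: (i) there exists a sequence $(\mathbf{a}_1,\ldots,\mathbf{a}_N)$ of $N$ points in $\mathbb{R}^d$ on which $\Phi$ holds everywhere; (ii) there exists an infinite sequence $(\mathbf{a}_1,\mathbf{a}_2,\ldots)$ of points in $\mathbb{R}^d$ on which $\Phi$ holds everywhere.
   Context: A $d$-dimensional $k$-ary algebraic predicate $\Phi(\mathbf{x}_1,\ldots,\mathbf{x}_k)$, $\mathbf{x}_i\in\mathbb{R}^d$, is a conjunction of polynomial equations $p(\mathbf{x}_1,\ldots,\mathbf{x}_k)=0$, the polynomials having rational coefficients and being polynomials in the $dk$ coordinates. $\Phi$ holds everywhere on a (finite or infinite) sequence $(\mathbf{a}_1,\mathbf{a}_2,\ldots)$ if $\Phi(\mathbf{a}_{i_1},\ldots,\mathbf{a}_{i_k})$ holds for all indices $i_1<i_2<\cdots<i_k$. *)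

theory Defs
  imports "HOL-Analysis.Analysis" "HOL-Library.Poly_Mapping"
begin

(* Rational polynomials in the variables (i, c): coordinate c of the i-th point, where the
   arguments of a k-ary predicate are numbered 0, ..., k - 1.  The outer mapping sends a monomial
   to its coefficient, the inner one sends a variable to its exponent. *)
type_synonym 'd qpoly = "((nat \<times> 'd) \<Rightarrow>\<^sub>0 nat) \<Rightarrow>\<^sub>0 rat"

definition qpoly_vars :: "'d qpoly \<Rightarrow> (nat \<times> 'd) set" where
  "qpoly_vars p = (\<Union>m\<in>Poly_Mapping.keys p. Poly_Mapping.keys m)"

definition monom_degree :: "('v \<Rightarrow>\<^sub>0 nat) \<Rightarrow> nat" where
  "monom_degree m = (\<Sum>v\<in>Poly_Mapping.keys m. Poly_Mapping.lookup m v)"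

(* Total degree; the zero polynomial gets degree 0. *)
definition qpoly_degree :: "'d qpoly \<Rightarrow> nat" where
  "qpoly_degree p = Max (insert 0 (monom_degree ` Poly_Mapping.keys p))"

definition qpoly_eval :: "'d::finite qpoly \<Rightarrow> (nat \<Rightarrow> real ^ 'd) \<Rightarrow> real" where
  "qpoly_eval p x =
     (\<Sum>m\<in>Poly_Mapping.keys p. of_rat (Poly_Mapping.lookup p m) *
        (\<Prod>(i, c)\<in>Poly_Mapping.keys m. (x i $ c) ^ Poly_Mapping.lookup m (i, c)))"

(* A k-ary algebraic predicate on real ^ 'd is given by the finite set of polynomials p whose
   equations p = 0 are its conjuncts.  Its argument tuple is a function of which only the values
   at 0, ..., k - 1 matter. *)
definition algebraic_predicate :: "nat \<Rightarrow> 'd qpoly set \<Rightarrow> bool" where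
  "algebraic_predicate k \<Phi> \<longleftrightarrow> finite \<Phi> \<and> (\<forall>p\<in>\<Phi>. qpoly_vars p \<subseteq> {..<k} \<times> UNIV)"

definition satisfies :: "(nat \<Rightarrow> real ^ 'd) \<Rightarrow> 'd::finite qpoly set \<Rightarrow> bool" where
  "satisfies x \<Phi> \<longleftrightarrow> (\<forall>p\<in>\<Phi>. qpoly_eval p x = 0)"

(* The sequence is the restriction of a to the index set I: {1..N} for a sequence of N points,
   {1..} for an infinite one.  Its points need not be distinct. *)
definition holds_everywhere ::
    "nat \<Rightarrow> 'd::finite qpoly set \<Rightarrow> nat set \<Rightarrow> (nat \<Rightarrow> real ^ 'd) \<Rightarrow> bool" where
  "holds_everywhere k \<Phi> I a \<longleftrightarrow>
     (\<forall>i :: nat \<Rightarrow> nat. strict_mono_on {..<k} i \<and> i ` {..<k} \<subseteq> I \<longrightarrow>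
        satisfies (\<lambda>j. a (i j)) \<Phi>)"

end

theory Submission
  imports Defs "HOL-Library.Function_Algebras"
begin

text \<open>
  Let \<open>V a\<close> be the vector of all monomials of degree at most \<open>D\<close> at the point \<open>a\<close>; these vectors
  lie in a space of dimension \<open>M = (d + D choose D)\<close>, and every equation of \<open>\<Phi>\<close> is a multilinear
  condition on \<open>V a\<^sub>1, \<dots>, V a\<^sub>k\<close>.  Cut \<open>(M + 1) ^ k\<close> points on which \<open>\<Phi>\<close> holds everywhere into
  \<open>M + 1\<close> consecutive blocks.  For dimension reasons the vectors of some block lie in the span \<open>W\<close>
  of the vectors of the preceding blocks.  By linearity in the first argument, increasing
  \<open>(k - 1)\<close>-tuples from that block satisfy the conditions for every first argument in \<open>W\<close>, so
  induction on \<open>k\<close> yields a point \<open>b\<close> of the block such that \<open>(w, V b, \<dots>, V b)\<close> satisfies them for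
  all \<open>w\<close> in \<open>W\<close>, in particular for \<open>w = V b\<close>.  Hence the constant sequence \<open>b, b, \<dots>\<close> will do.
\<close>

text \<open>Otherwise every step with \<open>n \<le> card B\<close> contributes a vector outside
  \<open>span (U n)\<close>; starting from the empty set, these accumulate to
  \<open>card B + 1\<close> independent vectors inside \<open>span B\<close>.\<close>

lemma (in vector_space) increasing_sets_span_stabilize:
  assumes "finite B" "mono U" and U: "\<And>n. U n \<subseteq> span B"
  shows "\<exists>n\<le>card B. U (Suc n) \<subseteq> span (U n)"
proof (rule ccontr)
  assume "\<not> ?thesis"
  then have new: "\<exists>u. u \<in> U (Suc n) \<and> u \<notin> span (U n)" if "n \<le> card B" for n
    using that by blast
  have "\<exists>S. independent S \<and> finite S \<and> card S = n \<and> S \<subseteq> U n" if "n \<le> Suc (card B)" for n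
    using that
  proof (induction n)
    case 0
    then show ?case by (intro exI[of _ "{}"]) (simp add: independent_empty)
  next
    case (Suc n)
    then obtain S where S: "independent S" "finite S" "card S = n" "S \<subseteq> U n"
      by auto
    obtain u where u: "u \<in> U (Suc n)" "u \<notin> span (U n)"
      using new Suc.prems by auto
    have "u \<notin> span S"
      using u(2) span_mono[OF S(4)] by blast
    moreover have "U n \<subseteq> U (Suc n)"
      using \<open>mono U\<close> by (simp add: mono_def)
    ultimately show ?case
      using S u(1) span_base[of u S]
      by (intro exI[of _ "insert u S"]) (auto simp: independent_insertI card_insert_if)
  qed
  then obtain S where "independent S" "card S = Suc (card B)" "S \<subseteq> U (Suc (card B))"
    by blast
  then show False
    using independent_span_bound[OF \<open>finite B\<close>, of S] U by fastforce
qed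

text \<open>The block argument in abstract form, by induction on \<open>k\<close>. The offset
  \<open>s\<close> and the predicate \<open>P\<close> stay general because the induction moves to a
  later block and absorbs the first slot into \<open>P\<close>.\<close>

lemma (in vector_space) slotwise_subspace_diagonal:
  assumes "finite B" and v: "\<And>i::nat. v i \<in> span B"
    and "\<And>ys zs. Suc (length ys + length zs) = k \<Longrightarrow> subspace {w. P (ys @ w # zs)}"
    and "\<And>is. length is = k \<Longrightarrow> sorted_wrt (<) is \<Longrightarrow> set is \<subseteq> {s..<s + (card B + 1) ^ k}
           \<Longrightarrow> P (map v is)"
  shows "\<exists>j\<in>{s..<s + (card B + 1) ^ k}. P (replicate k (v j))"
  using assms(3,4)
proof (induction k arbitrary: P s)
  case 0
  from "0.prems"(2)[of "[]"] show ?case by simp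
next
  case (Suc k)
  define L where "L = (card B + 1) ^ k"
  \<comment> \<open>The vectors of the first \<open>n\<close> blocks of length \<open>L\<close>.
    Since \<open>n \<le> card B\<close> below, block number \<open>n\<close>, counted from 0, still
    fits among the \<open>card B + 1\<close> blocks.\<close>
  define U where "U n = v ` {s..<s + n * L}" for n
  have "mono U"
    unfolding U_def mono_def by (auto intro!: image_mono) (meson add_le_cancel_left less_le_trans mult_le_mono1)
  moreover have "U n \<subseteq> span B" for n
    using v by (auto simp: U_def)
  ultimately obtain n where n: "n \<le> card B" "U (Suc n) \<subseteq> span (U n)"
    using increasing_sets_span_stabilize[OF \<open>finite B\<close>, of U] by blast
  define W where "W = span (U n)"
  have "(n + 1) * L \<le> (card B + 1) * L"
    using n(1) by (intro mult_le_mono1) simp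
  then have le: "s + n * L + L \<le> s + (card B + 1) ^ Suc k"
    by (simp add: L_def algebra_simps)
  \<comment> \<open>The new predicate quantifies over all first entries in \<open>W\<close>; its
    slots remain subspaces, being intersections of subspaces.\<close>
  have "\<exists>j\<in>{s + n * L..<s + n * L + (card B + 1) ^ k}. \<forall>w\<in>W. P (w # replicate k (v j))"
  proof (rule Suc.IH)
    fix ys zs :: "'b list"
    assume "Suc (length ys + length zs) = k"
    then have "subspace {x. P ((w # ys) @ x # zs)}" for w
      by (intro Suc.prems(1)) simp
    then show "subspace {x. \<forall>w\<in>W. P (w # ys @ x # zs)}"
      by (simp add: subspace_def)
  next
    fix js :: "nat list"
    assume js: "length js = k" "sorted_wrt (<) js"
      "set js \<subseteq> {s + n * L..<s + n * L + (card B + 1) ^ k}"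
    have "U n \<subseteq> {w. P (w # map v js)}"
    proof
      fix u assume "u \<in> U n"
      then obtain i where i: "u = v i" "s \<le> i" "i < s + n * L"
        by (auto simp: U_def)
      \<comment> \<open>The index \<open>i\<close> lies in an earlier block than all of
        \<open>js\<close>, so \<open>i # js\<close> is still increasing.\<close>
      have "P (map v (i # js))"
      proof (rule Suc.prems(2))
        show "set (i # js) \<subseteq> {s..<s + (card B + 1) ^ Suc k}"
        proof
          fix x assume "x \<in> set (i # js)"
          then have "s \<le> x \<and> x < s + n * L + L"
            using js(3) i by (auto simp: L_def)
          then show "x \<in> {s..<s + (card B + 1) ^ Suc k}"
            using le by simp
        qed
      qed (use js i in fastforce)+
      then show "u \<in> {w. P (w # map v js)}"
        using i by simp
    qed
    moreover have "subspace {w. P ([] @ w # map v js)}"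
      by (rule Suc.prems(1)) (simp add: js)
    ultimately show "\<forall>w\<in>W. P (w # map v js)"
      using span_minimal[of "U n" "{w. P (w # map v js)}"] by (auto simp: W_def)
  qed
  then obtain j where j: "s + n * L \<le> j" "j < s + n * L + L" "\<And>w. w \<in> W \<Longrightarrow> P (w # replicate k (v j))"
    by (auto simp: L_def)
  have "v j \<in> U (Suc n)"
    unfolding U_def using j(1,2) by (intro imageI) (simp add: algebra_simps)
  then have "P (replicate (Suc k) (v j))"
    using n(2) j(3) by (auto simp: W_def)
  then show ?case
    using j(1,2) le by (intro bexI[of _ j]) auto
qed

text \<open>Stars and bars: appending the slack \<open>D - sum e UNIV\<close> turns the bound into
  an equation, so exponent vectors inject into the lists of length \<open>CARD('d) + 1\<close> with
  sum \<open>D\<close>.\<close>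

lemma
  fixes D :: nat
  shows finite_exponents_le: "finite {e :: 'd::finite \<Rightarrow> nat. sum e UNIV \<le> D}"
    and card_exponents_le: "card {e :: 'd \<Rightarrow> nat. sum e UNIV \<le> D} \<le> (CARD('d) + D) choose D"
proof -
  obtain xs :: "'d list" where xs: "set xs = UNIV" "distinct xs"
    using finite_distinct_list[of UNIV] finite by blast
  then have len: "length xs = CARD('d)"
    using distinct_card by fastforce
  let ?E = "{e :: 'd \<Rightarrow> nat. sum e UNIV \<le> D}"
  let ?L = "{l :: nat list. length l = CARD('d) + 1 \<and> sum_list l = D}"
  let ?f = "\<lambda>e :: 'd \<Rightarrow> nat. map e xs @ [D - sum e UNIV]"
  have "inj_on ?f ?E"
  proof (rule inj_onI)
    fix e e' assume "?f e = ?f e'"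
    then have "\<forall>x\<in>set xs. e x = e' x" by simp
    then show "e = e'" using xs by (simp add: fun_eq_iff)
  qed
  moreover have "?f ` ?E \<subseteq> ?L"
    using xs len by (auto simp: sum_list_distinct_conv_sum_set)
  moreover have "?L \<subseteq> {l. set l \<subseteq> {..D} \<and> length l = CARD('d) + 1}"
    using member_le_sum_list by fastforce
  then have "finite ?L"
    by (rule finite_subset) (simp add: finite_lists_length_eq)
  moreover have "card ?L = (CARD('d) + D) choose D"
    by (subst card_length_sum_list) (simp add: add.commute)
  ultimately show "finite ?E" "card ?E \<le> (CARD('d) + D) choose D"
    using card_inj_on_le[of ?f ?E ?L] finite_imageD[of ?f ?E] finite_subset[of "?f ` ?E" ?L]
    by auto
qed

text \<open>Makes the two span lemmas above applicable to functions on exponent vectors.\<close>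

interpretation fun_space: vector_space "\<lambda>(c::real) (f::'a \<Rightarrow> real) x. c * f x"
  by unfold_locales (auto simp: fun_eq_iff algebra_simps)

lemma fun_in_span_indicators:
  fixes f :: "'a \<Rightarrow> real"
  assumes "finite E" and f: "\<And>x. x \<notin> E \<Longrightarrow> f x = 0"
  shows "f \<in> fun_space.span ((\<lambda>e. indicator {e}) ` E)"
proof -
  have sum_apply: "(\<Sum>e\<in>E. g e) x = (\<Sum>e\<in>E. g e x)" for g :: "'a \<Rightarrow> 'a \<Rightarrow> real" and x
    using \<open>finite E\<close> by (induction E) simp_all
  have "f = (\<Sum>e\<in>E. (\<lambda>x. f e * indicator {e} x))"
  proof
    fix x
    have "(\<Sum>e\<in>E. (\<lambda>x. f e * indicator {e} x)) x = (\<Sum>e\<in>E. f e * indicator {e} x)"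
      by (rule sum_apply)
    also have "\<dots> = (\<Sum>e\<in>E. if e = x then f e else 0)"
      by (intro sum.cong) (auto simp: indicator_def)
    finally show "f x = (\<Sum>e\<in>E. (\<lambda>x. f e * indicator {e} x)) x"
      using \<open>finite E\<close> f[of x] by simp
  qed
  also have "\<dots> \<in> fun_space.span ((\<lambda>e. indicator {e}) ` E)"
    by (intro fun_space.span_sum fun_space.span_scale fun_space.span_base imageI)
  finally show ?thesis .
qed

text \<open>Coordinates are indexed by exponent vectors. The value 0 beyond degree \<open>D\<close>
  keeps all these vectors in the span of finitely many indicators.\<close>

definition veronese :: "nat \<Rightarrow> real ^ 'd \<Rightarrow> ('d::finite \<Rightarrow> nat) \<Rightarrow> real" where
  "veronese D a e = (if sum e UNIV \<le> D then \<Prod>c\<in>UNIV. (a $ c) ^ e c else 0)"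

text \<open>A monomial factors into one monomial per point; the factor belonging to point
  \<open>i\<close> is replaced by the coordinate of \<open>fs ! i\<close> at its exponents.\<close>

definition multilinear_eval :: "'d qpoly \<Rightarrow> (('d \<Rightarrow> nat) \<Rightarrow> real) list \<Rightarrow> real" where
  "multilinear_eval p fs = (\<Sum>m\<in>Poly_Mapping.keys p. of_rat (Poly_Mapping.lookup p m) *
     (\<Prod>i<length fs. (fs ! i) (\<lambda>c. Poly_Mapping.lookup m (i, c))))"

lemma subspace_multilinear_eval_zero:
  "fun_space.subspace {f. multilinear_eval p (ys @ f # zs) = 0}"
proof -
  \<comment> \<open>The coefficient left after splitting off slot \<open>length ys\<close>. The zero
    function is a placeholder in that slot, which the product skips, so \<open>C m\<close> does not
    depend on \<open>f\<close>.\<close>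
  define C where "C m = of_rat (Poly_Mapping.lookup p m) *
      (\<Prod>i\<in>{..<length ys + Suc (length zs)} - {length ys}.
         ((ys @ (\<lambda>_. 0) # zs) ! i) (\<lambda>c. Poly_Mapping.lookup m (i, c)))" for m
  have "multilinear_eval p (ys @ f # zs) =
      (\<Sum>m\<in>Poly_Mapping.keys p. C m * f (\<lambda>c. Poly_Mapping.lookup m (length ys, c)))" for f
    unfolding multilinear_eval_def
  proof (intro sum.cong refl)
    fix m
    have "(\<Prod>i<length (ys @ f # zs). ((ys @ f # zs) ! i) (\<lambda>c. Poly_Mapping.lookup m (i, c))) =
        f (\<lambda>c. Poly_Mapping.lookup m (length ys, c)) *
        (\<Prod>i\<in>{..<length ys + Suc (length zs)} - {length ys}.
          ((ys @ f # zs) ! i) (\<lambda>c. Poly_Mapping.lookup m (i, c)))"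
      by (subst prod.remove[of _ "length ys"]) auto
    also have "(\<Prod>i\<in>{..<length ys + Suc (length zs)} - {length ys}.
          ((ys @ f # zs) ! i) (\<lambda>c. Poly_Mapping.lookup m (i, c))) =
        (\<Prod>i\<in>{..<length ys + Suc (length zs)} - {length ys}.
          ((ys @ (\<lambda>_. 0) # zs) ! i) (\<lambda>c. Poly_Mapping.lookup m (i, c)))"
      by (intro prod.cong refl) (auto simp: nth_append nth_Cons split: nat.split)
    finally show "of_rat (Poly_Mapping.lookup p m) *
        (\<Prod>i<length (ys @ f # zs). ((ys @ f # zs) ! i) (\<lambda>c. Poly_Mapping.lookup m (i, c))) =
        C m * f (\<lambda>c. Poly_Mapping.lookup m (length ys, c))"
      by (simp add: C_def)
  qed
  then show ?thesis
    by (auto simp: fun_space.subspace_def algebra_simps sum.distrib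
        simp flip: sum_distrib_left)
qed

text \<open>The exponents of a monomial at a single point sum to at most its total degree, hence to
  at most \<open>D\<close>, so \<open>veronese\<close> never falls back on its default 0
  here.\<close>

lemma multilinear_eval_veronese:
  fixes p :: "'d::finite qpoly"
  assumes vars: "qpoly_vars p \<subseteq> {..<k} \<times> UNIV" and deg: "qpoly_degree p \<le> D"
    and "length as = k" and x: "\<And>i. i < k \<Longrightarrow> x i = as ! i"
  shows "multilinear_eval p (map (veronese D) as) = qpoly_eval p x"
  unfolding multilinear_eval_def qpoly_eval_def
proof (intro sum.cong refl arg_cong2[where f = "(*)"])
  fix m assume m: "m \<in> Poly_Mapping.keys p"
  let ?lk = "Poly_Mapping.lookup m"
  have keys: "Poly_Mapping.keys m \<subseteq> {..<k} \<times> UNIV"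
    using vars m by (auto simp: qpoly_vars_def)
  have "monom_degree m \<le> qpoly_degree p"
    unfolding qpoly_degree_def using m by (intro Max_ge) auto
  then have "(\<Sum>v\<in>{..<k} \<times> UNIV. ?lk v) \<le> D"
    using deg sum.mono_neutral_left[OF _ keys, of ?lk]
    by (simp add: monom_degree_def in_keys_iff)
  then have sum_le: "(\<Sum>c\<in>UNIV. ?lk (i, c)) \<le> D" if "i < k" for i
    using that member_le_sum[of i "{..<k}" "\<lambda>i. \<Sum>c\<in>UNIV. ?lk (i, c)"]
    by (simp add: sum.cartesian_product)
  have "(\<Prod>i<length (map (veronese D) as). (map (veronese D) as ! i) (\<lambda>c. ?lk (i, c))) =
      (\<Prod>i<k. \<Prod>c\<in>UNIV. (x i $ c) ^ ?lk (i, c))"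
    using \<open>length as = k\<close> x sum_le by (intro prod.cong) (auto simp: veronese_def)
  also have "\<dots> = (\<Prod>(i, c)\<in>{..<k} \<times> UNIV. (x i $ c) ^ ?lk (i, c))"
    by (simp add: prod.cartesian_product)
  \<comment> \<open>Variables outside the keys have exponent 0 and give the factor 1.\<close>
  also have "\<dots> = (\<Prod>(i, c)\<in>Poly_Mapping.keys m. (x i $ c) ^ ?lk (i, c))"
    using keys by (intro prod.mono_neutral_right) (auto simp: in_keys_iff)
  finally show "(\<Prod>i<length (map (veronese D) as). (map (veronese D) as ! i) (\<lambda>c. ?lk (i, c))) =
      (\<Prod>(i, c)\<in>Poly_Mapping.keys m. (x i $ c) ^ ?lk (i, c))" .
qed

theorem theorem8:
  fixes D k :: nat
  shows "\<exists>N :: nat. N \<le> (((CARD('d::finite) + D) choose D) + 1) ^ k \<and>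
    (\<forall>\<Phi> :: 'd qpoly set. algebraic_predicate k \<Phi> \<and> (\<forall>p\<in>\<Phi>. qpoly_degree p \<le> D) \<longrightarrow>
       ((\<exists>a :: nat \<Rightarrow> real ^ 'd. holds_everywhere k \<Phi> {1..N} a) \<longleftrightarrow>
        (\<exists>a :: nat \<Rightarrow> real ^ 'd. holds_everywhere k \<Phi> {1..} a)))"
proof -
  let ?E = "{e :: 'd \<Rightarrow> nat. sum e UNIV \<le> D}"
  define B :: "(('d \<Rightarrow> nat) \<Rightarrow> real) set" where "B = (\<lambda>e. indicator {e}) ` ?E"
  have "finite B"
    unfolding B_def by (simp add: finite_exponents_le)
  have in_span: "veronese D a \<in> fun_space.span B" for a :: "real ^ 'd"
    unfolding B_def by (intro fun_in_span_indicators finite_exponents_le) (simp add: veronese_def)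
  have "card B \<le> card ?E"
    unfolding B_def by (simp add: card_image_le finite_exponents_le)
  also have "\<dots> \<le> (CARD('d) + D) choose D"
    by (rule card_exponents_le)
  \<comment> \<open>The witness for \<open>N\<close> is \<open>(card B + 1) ^ k\<close>, fixed
    before \<open>\<Phi>\<close> is chosen.\<close>
  finally have N_le: "(card B + 1) ^ k \<le> (((CARD('d) + D) choose D) + 1) ^ k"
    by (intro power_mono) auto
  have "\<exists>a :: nat \<Rightarrow> real ^ 'd. holds_everywhere k \<Phi> {1..} a"
    if \<Phi>: "algebraic_predicate k \<Phi>" "\<forall>p\<in>\<Phi>. qpoly_degree p \<le> D"
      and a: "holds_everywhere k \<Phi> {1..(card B + 1) ^ k} a"
    for \<Phi> and a :: "nat \<Rightarrow> real ^ 'd"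
  proof -
    have eval: "multilinear_eval p (map (veronese D) as) = qpoly_eval p x"
      if "p \<in> \<Phi>" "length as = k" "\<And>i. i < k \<Longrightarrow> x i = as ! i" for p as x
      using \<Phi> that by (intro multilinear_eval_veronese) (auto simp: algebraic_predicate_def)
    \<comment> \<open>The offset is \<open>s = 1\<close> because sequences start at index 1, and
      \<open>P\<close> is the simultaneous vanishing of the multilinear forms of all polynomials in
      \<open>\<Phi>\<close>.\<close>
    have "\<exists>j\<in>{1..<1 + (card B + 1) ^ k}.
        \<forall>p\<in>\<Phi>. multilinear_eval p (replicate k (veronese D (a j))) = 0"
    proof (rule fun_space.slotwise_subspace_diagonal[OF \<open>finite B\<close> in_span])
      fix ys zs :: "(('d \<Rightarrow> nat) \<Rightarrow> real) list"
      show "fun_space.subspace {f. \<forall>p\<in>\<Phi>. multilinear_eval p (ys @ f # zs) = 0}"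
        using subspace_multilinear_eval_zero[of _ ys zs] by (simp add: fun_space.subspace_def)
    next
      fix js :: "nat list"
      assume js: "length js = k" "sorted_wrt (<) js" "set js \<subseteq> {1..<1 + (card B + 1) ^ k}"
      have "strict_mono_on {..<k} ((!) js)"
        using js by (auto simp: strict_mono_on_def sorted_wrt_iff_nth_less)
      moreover have "(!) js ` {..<k} \<subseteq> {1..(card B + 1) ^ k}"
        using js nth_mem by fastforce
      ultimately have "satisfies (\<lambda>j. a (js ! j)) \<Phi>"
        using a by (auto simp: holds_everywhere_def)
      then show "\<forall>p\<in>\<Phi>. multilinear_eval p (map (\<lambda>j. veronese D (a j)) js) = 0"
        using eval[of _ "map a js" "\<lambda>j. a (js ! j)"] js(1)
        by (simp add: satisfies_def comp_def)
    qed
    then obtain j where "\<forall>p\<in>\<Phi>. multilinear_eval p (replicate k (veronese D (a j))) = 0"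
      by blast
    then have "satisfies (\<lambda>_. a j) \<Phi>"
      using eval[of _ "replicate k (a j)" "\<lambda>_. a j"] by (simp add: satisfies_def)
    then show ?thesis
      by (intro exI[of _ "\<lambda>_. a j"]) (simp add: holds_everywhere_def)
  qed
  \<comment> \<open>Conversely, an infinite sequence restricts to its first \<open>N\<close>
    points.\<close>
  moreover have "holds_everywhere k \<Phi> {1..(card B + 1) ^ k} a"
    if "holds_everywhere k \<Phi> {1..} a" for \<Phi> and a :: "nat \<Rightarrow> real ^ 'd"
    using that unfolding holds_everywhere_def by fastforce
  ultimately show ?thesis
    using N_le by blast
qed

end
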